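(* Let $\mathbf{G}$ be a semigroup which is right cancellative and in which, for all $a, b \in \mathbf{G}$, the equation $aX = b$ has infinitely many solutions $X \in \mathbf{G}$. Then $\mathbf{G}$ is not finitely generated as a semigroup.
   Context: A semigroup is a non-empty set with an associative binary operation. Right cancellative means: $xa = ya$ implies $x = y$ for all $a,x,y$. A semigroup is finitely generated if there are finitely many elements $A_1,\dots,A_m$ such that every element is a finite non-empty product of the $A_i$ (with repetitions allowed). *)

theory Defs
  imports Main
begin

definition right_cancellative :: "'a::semigroup_mult itself \<Rightarrow> bool" where
  "right_cancellative _ \<longleftrightarrow> (\<forall>a x y :: 'a. x * a = y * a \<longrightarrow> x = y)"

text \<open>A semigroup has no unit, so \<open>prod_list\<close> is unavailable. The product of the non-empty
  list \<open>x # xs\<close> is \<open>foldl (*) x xs\<close>.\<close>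

definition finitely_generated_semigroup :: "'a::semigroup_mult itself \<Rightarrow> bool" where
  "finitely_generated_semigroup _ \<longleftrightarrow>
    (\<exists>A :: 'a set. finite A \<and>
      (\<forall>g. \<exists>x xs. set (x # xs) \<subseteq> A \<and> g = foldl (*) x xs))"

end

theory Submission
  imports Defs
begin

text \<open>
  Divisibility on the right, \<open>x \<in> G y\<close>, is transitive. If \<open>G\<close> is generated by a finite set \<open>A\<close>,
  solvability of \<open>x X = x\<close> puts every \<open>x\<close> into \<open>G j\<close>, where \<open>j \<in> A\<close> is the last letter of \<open>X\<close>.
  A finite set cannot carry an infinite strictly descending chain, so \<open>j \<in> G j\<close> for some
  \<open>j \<in> A\<close>, say \<open>j = e j\<close>. Cancelling \<open>j\<close> in \<open>e e j = e j\<close> shows that \<open>e\<close> is idempotent, and as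
  every \<open>b\<close> has the form \<open>e X\<close>, \<open>e\<close> is a left identity. But then \<open>e X = b\<close> has only one solution.
\<close>

text \<open>Take \<open>x\<close> in \<open>A\<close> with the fewest \<open>R\<close>-successors in
  \<open>A\<close>, and a successor \<open>y\<close>. By transitivity and minimality
  \<open>y\<close> has the same successors as \<open>x\<close>, hence itself among them.\<close>

lemma transitive_serial_on_finite_has_loop:
  assumes "finite A" "A \<noteq> {}"
    and serial: "\<And>x. x \<in> A \<Longrightarrow> \<exists>y\<in>A. R x y"
    and trans: "\<And>x y z. R x y \<Longrightarrow> R y z \<Longrightarrow> R x z"
  shows "\<exists>x\<in>A. R x x"
proof -
  let ?I = "\<lambda>x. {y \<in> A. R x y}"
  obtain x where x: "x \<in> A" and min: "\<And>y. y \<in> A \<Longrightarrow> card (?I x) \<le> card (?I y)"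
    using ex_min_if_finite[of "(\<lambda>x. card (?I x)) ` A"] assms(1,2)
    by (auto simp: not_less)
  obtain y where y: "y \<in> A" "R x y"
    using serial x by blast
  have "?I y \<subseteq> ?I x"
    using y trans by blast
  then have "?I y = ?I x"
    using min[OF y(1)] assms(1) by (intro card_seteq) auto
  with y show ?thesis by blast
qed

lemma generator_right_divides:
  fixes x :: "'a::semigroup_mult"
  assumes gen: "\<forall>g. \<exists>y ys. set (y # ys) \<subseteq> A \<and> g = foldl (*) y ys"
    and solv: "\<And>a b :: 'a. \<exists>X. a * X = b"
  shows "\<exists>j\<in>A. \<exists>u. x = u * j"
proof -
  obtain X where X: "x * X = x" using solv by blast
  obtain y ys where ys: "set (y # ys) \<subseteq> A" "X = foldl (*) y ys" using gen by blast
  show ?thesis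
  \<comment> \<open>Without a unit, a one-letter \<open>X\<close> is a separate case: there
    \<open>u\<close> is \<open>x\<close> itself; otherwise \<open>u\<close> is \<open>x\<close>
    times \<open>X\<close> without its last letter.\<close>
  proof (cases ys rule: rev_cases)
    case Nil
    then have "x = x * y" "y \<in> A" using X ys by auto
    then show ?thesis by blast
  next
    case (snoc zs j)
    then have "x = (x * foldl (*) y zs) * j"
      using X ys by (simp add: mult.assoc)
    moreover have "j \<in> A" using ys(1) snoc by simp
    ultimately show ?thesis by blast
  qed
qed

theorem mainTheorem3:
  assumes "right_cancellative TYPE('a::semigroup_mult)"
    and "\<And>a b :: 'a. infinite {X. a * X = b}"
  shows "\<not> finitely_generated_semigroup TYPE('a)"
proof
  assume "finitely_generated_semigroup TYPE('a)"
  then obtain A :: "'a set" where "finite A"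
    and gen: "\<forall>g. \<exists>y ys. set (y # ys) \<subseteq> A \<and> g = foldl (*) y ys"
    unfolding finitely_generated_semigroup_def by blast
  have solv: "\<exists>X. a * X = b" for a b :: 'a
    using infinite_imp_nonempty[OF assms(2)] by blast
  have cancel: "x = y" if "x * a = y * a" for a x y :: 'a
    using assms(1) that unfolding right_cancellative_def by blast
  have "\<exists>j\<in>A. \<exists>u. j = u * j"
  proof (rule transitive_serial_on_finite_has_loop[where R = "\<lambda>x y. \<exists>u. x = u * y"])
    show "finite A" by fact
    \<comment> \<open>The type is inhabited, and any element's factorization has a first letter in
      \<open>A\<close>.\<close>
    show "A \<noteq> {}" using gen by force
    show "\<exists>j\<in>A. \<exists>u. x = u * j" for x
      by (rule generator_right_divides[OF gen solv])
    show "\<exists>u. x = u * z" if "\<exists>u. x = u * y" "\<exists>u. y = u * z" for x y z :: 'a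
      using that by (metis mult.assoc)
  qed
  then obtain e j :: 'a where "j = e * j" by blast
  then have idem: "e * e = e"
    by (metis cancel mult.assoc)
  have left_id: "e * b = b" for b
    using solv[of e b] idem by (metis mult.assoc)
  have "{X. e * X = e} = {e}"
    by (simp add: left_id)
  then show False
    using assms(2)[of e e] by simp
qed

end
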